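(* A tournament $T$ is $\vec C_3$-decomposable if and only if it has no copies of $T_5^8$, $T_5^{10}$ nor of $T_5^{12}$ (that is, no subtournament of $T$ induced by $5$ vertices is isomorphic to one of $T_5^8$, $T_5^{10}$, $T_5^{12}$).
   Context: A tournament is a finite directed graph without loops having exactly one arc between each pair of distinct vertices (the empty tournament is allowed). $V(T)$ and $A(T)$ are the vertex and arc sets, and $T|_W$ is the subtournament induced by $W\subset V(T)$. $\vec C_3$-decomposability is defined recursively. Every tournament of size $0$ or $1$ is $\vec C_3$-decomposable. A tournament $T$ of size $n\ge2$ is $\vec C_3$-decomposable if there exist pairwise disjoint (possibly empty) sets $A,B,C\subsetneq V(T)$ with $A\cup B\cup C=V(T)$, such that $T|_A,T|_B,T|_C$ are all $\vec C_3$-decomposable and $A\times B,\ B\times C,\ C\times A\subset A(T)$ (all arcs go from $A$ to $B$, from $B$ to $C$ and from $C$ to $A$). The forbidden tournaments are: - $T_5^8$: vertices $1,\dots,5$, arcs $1\to2,\ 1\to3,\ 1\to4,\ 2\to3,\ 2\to4,\ 2\to5,\ 3\to4,\ 4\to5,\ 5\to1,\ 5\to3$. - $T_5^{10}$: vertices $1,\dots,5$, arcs $1\to2,\ 1\to4,\ 2\to3,\ 2\to4,\ 3\to1,\ 3\to4,\ 3\to5,\ 4\to5,\ 5\to1,\ 5\to2$. - $T_5^{12}$: vertices $\mathbb{Z}_5$, arcs $i\to i+1$ and $i\to i+2$ for all $i$. *)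

theory Defs
  imports "Graph_Theory.Pair_Digraph" "Graph_Theory.Digraph_Isomorphism"
begin

text \<open>The locale \<^locale>\<open>digraph\<close> provides finiteness and excludes loops and
  parallel arcs; the empty digraph is allowed.\<close>

locale tournament = digraph +
  assumes exactly_one_arc:
    "\<lbrakk>u \<in> verts G; v \<in> verts G; u \<noteq> v\<rbrakk> \<Longrightarrow> (u, v) \<in> arcs_ends G \<longleftrightarrow> (v, u) \<notin> arcs_ends G"

inductive C3_decomposable :: "('a, 'b) pre_digraph \<Rightarrow> bool" where
  small: "\<lbrakk>tournament T; card (verts T) \<le> 1\<rbrakk> \<Longrightarrow> C3_decomposable T"
| decompose: "\<lbrakk>tournament T; card (verts T) \<ge> 2;
    A \<subset> verts T; B \<subset> verts T; C \<subset> verts T;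
    A \<inter> B = {}; B \<inter> C = {}; C \<inter> A = {}; A \<union> B \<union> C = verts T;
    C3_decomposable (T \<restriction> A); C3_decomposable (T \<restriction> B); C3_decomposable (T \<restriction> C);
    A \<times> B \<subseteq> arcs_ends T; B \<times> C \<subseteq> arcs_ends T; C \<times> A \<subseteq> arcs_ends T\<rbrakk>
    \<Longrightarrow> C3_decomposable T"

definition has_copy :: "('a, 'b) pre_digraph \<Rightarrow> ('c, 'd) pre_digraph \<Rightarrow> bool" where
  "has_copy T H \<longleftrightarrow>
    (\<exists>W \<subseteq> verts T. card W = card (verts H) \<and> digraph_iso (T \<restriction> W) H)"

definition T5_8 :: "(nat, nat \<times> nat) pre_digraph" where
  "T5_8 = with_proj \<lparr> pverts = {1, 2, 3, 4, 5},
    parcs = {(1,2), (1,3), (1,4), (2,3), (2,4), (2,5), (3,4), (4,5), (5,1), (5,3)} \<rparr>"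

definition T5_10 :: "(nat, nat \<times> nat) pre_digraph" where
  "T5_10 = with_proj \<lparr> pverts = {1, 2, 3, 4, 5},
    parcs = {(1,2), (1,4), (2,3), (2,4), (3,1), (3,4), (3,5), (4,5), (5,1), (5,2)} \<rparr>"

text \<open>The residues modulo 5 are represented by \<open>0, \<dots>, 4\<close>.\<close>

definition T5_12 :: "(nat, nat \<times> nat) pre_digraph" where
  "T5_12 = with_proj \<lparr> pverts = {0..<5},
    parcs = {(i, (i + 1) mod 5) | i. i < 5} \<union> {(i, (i + 2) mod 5) | i. i < 5} \<rparr>"

lemma tournament_with_projI:
  assumes "finite (pverts G)" and sub: "\<forall>e\<in>parcs G. fst e \<in> pverts G \<and> snd e \<in> pverts G \<and> fst e \<noteq> snd e"
    and one: "\<forall>u\<in>pverts G. \<forall>v\<in>pverts G. u \<noteq> v \<longrightarrow> ((u, v) \<in> parcs G \<longleftrightarrow> (v, u) \<notin> parcs G)"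
  shows "tournament (with_proj G)"
proof -
  have "parcs G \<subseteq> pverts G \<times> pverts G" using sub by auto
  then have "finite (parcs G)" using assms(1) finite_subset by blast
  then interpret pair_digraph G
    using assms(1) sub by unfold_locales auto
  show ?thesis
    by unfold_locales (simp only: with_proj_simps, use one in blast)
qed

lemma tournament_T5_8: "tournament T5_8"
  unfolding T5_8_def by (rule tournament_with_projI) simp_all

lemma tournament_T5_10: "tournament T5_10"
  unfolding T5_10_def by (rule tournament_with_projI) simp_all

lemma tournament_T5_12: "tournament T5_12"
proof -
  have V: "{0..<5} = {0, 1, 2, 3, 4::nat}" by auto
  have "{(i, (i + k) mod 5) | i. i < (5::nat)} = (\<lambda>i. (i, (i + k) mod 5)) ` {0..<5}" for k
    unfolding image_def by auto
  from this[of 1] this[of 2] show ?thesis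
    unfolding T5_12_def by (intro tournament_with_projI) (simp_all add: V)
qed

end

theory Submission
  imports Defs
begin

text \<open>A tournament with a partition \<open>A \<rightarrow> B \<rightarrow> C \<rightarrow> A\<close> passes it on to every subtournament not contained
  in a single part, and the three forbidden tournaments admit no such partition. Conversely, take
  nonempty sets \<open>A \<rightarrow> B \<rightarrow> C \<rightarrow> A\<close> with \<open>S = A \<union> B \<union> C\<close> maximal. If some vertex outside \<open>S\<close> is neither
  above nor below all of \<open>S\<close>, then either it can be added to one of the three sets or it spans a
  forbidden tournament with four vertices of \<open>S\<close>. Otherwise, unless the tournament splits into two
  parts, there are vertices \<open>u, w\<close> outside \<open>S\<close> with \<open>S \<rightarrow> u \<rightarrow> w \<rightarrow> S\<close>, against maximality.\<close>

section \<open>Induced subtournaments and elementary arc rules\<close>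

lemma (in digraph) digraph_induce_subgraph:
  assumes "W \<subseteq> verts G" shows "digraph (G \<restriction> W)"
proof -
  interpret H: wf_digraph "G \<restriction> W" by (rule wellformed_induce_subgraph)
  show ?thesis
    using assms finite_subset[OF assms finite_verts] no_loops no_multi_arcs
    by unfold_locales auto
qed

lemma arcs_ends_induce_subgraph:
  "u \<rightarrow>\<^bsub>G \<restriction> W\<^esub> v \<longleftrightarrow> u \<in> W \<and> v \<in> W \<and> u \<rightarrow>\<^bsub>G\<^esub> v"
  by (auto simp: arcs_ends_conv)

lemma (in tournament) tournament_induce_subgraph:
  assumes "W \<subseteq> verts G" shows "tournament (G \<restriction> W)"
proof -
  interpret H: digraph "G \<restriction> W" by (rule digraph_induce_subgraph[OF assms])
  show ?thesis
    using assms exactly_one_arc by unfold_locales (auto simp: arcs_ends_induce_subgraph)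
qed

context tournament
begin

lemma arc_irrefl: "\<not> x \<rightarrow> x"
  using no_loops by (auto simp: arcs_ends_conv)

lemma arc_asym: "x \<rightarrow> y \<Longrightarrow> \<not> y \<rightarrow> x"
  by (metis adj_in_verts arc_irrefl exactly_one_arc)

lemma arc_total: "\<lbrakk>x \<in> verts G; y \<in> verts G; x \<noteq> y; \<not> x \<rightarrow> y\<rbrakk> \<Longrightarrow> y \<rightarrow> x"
  using exactly_one_arc by blast

end

subsection \<open>Copies as arc-preserving maps\<close>

text \<open>Inverting the isomorphism gives one out of \<open>H\<close>; its vertex component is the
  embedding \<open>f\<close>. From here on a copy is handled as a map on vertices, independently of
  the arc types.\<close>

lemma has_copyE:
  assumes "tournament T" "has_copy T H"
  obtains f where "inj_on f (verts H)" "f ` verts H \<subseteq> verts T"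
    "\<And>x y. x \<rightarrow>\<^bsub>H\<^esub> y \<Longrightarrow> f x \<rightarrow>\<^bsub>T\<^esub> f y"
proof -
  interpret tournament T by fact
  obtain W where W: "W \<subseteq> verts T" "digraph_iso (T \<restriction> W) H"
    using assms(2) unfolding has_copy_def by auto
  have "digraph_iso H (T \<restriction> W)"
    using W(2) by (rule digraph_iso_swap[OF wellformed_induce_subgraph])
  then obtain h where h: "pre_digraph.digraph_isomorphism H h" "T \<restriction> W = app_iso h H"
    unfolding digraph_iso_def by auto
  then have wf: "wf_digraph H" by (simp add: pre_digraph.digraph_isomorphism_def)
  have ends: "arcs_ends (T \<restriction> W) = (\<lambda>(u,v). (iso_verts h u, iso_verts h v)) ` arcs_ends H"
    unfolding h(2) by (rule wf_digraph.arcs_ends_app_iso_eq[OF wf h(1)])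
  have verts: "W = iso_verts h ` verts H"
    using arg_cong[OF h(2), of verts] by simp
  show ?thesis
  proof (rule that[of "iso_verts h"])
    show "inj_on (iso_verts h) (verts H)"
      using h(1) by (rule pre_digraph.digraph_isomorphism_inj_on_verts)
    show "iso_verts h ` verts H \<subseteq> verts T" using W(1) verts by simp
    show "iso_verts h x \<rightarrow>\<^bsub>T\<^esub> iso_verts h y" if "x \<rightarrow>\<^bsub>H\<^esub> y" for x y
    proof -
      have "iso_verts h x \<rightarrow>\<^bsub>T \<restriction> W\<^esub> iso_verts h y" unfolding ends using that by force
      then show ?thesis by (simp add: arcs_ends_induce_subgraph)
    qed
  qed
qed

text \<open>Preserving arcs is enough between tournaments. Two distinct vertices of \<open>H\<close>
  are joined by an arc, whose image is not a loop, so \<open>f\<close> is injective; and since the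
  reverse arc is excluded in \<open>T\<close>, \<open>f\<close> also reflects arcs.\<close>

lemma has_copyI:
  assumes "tournament T" "tournament H" and sub: "f ` verts H \<subseteq> verts T"
    and hom: "\<And>x y. x \<rightarrow>\<^bsub>H\<^esub> y \<Longrightarrow> f x \<rightarrow>\<^bsub>T\<^esub> f y"
  shows "has_copy T H"
proof -
  interpret T: tournament T by fact
  interpret H: tournament H by fact
  define W where "W = f ` verts H"
  have inj: "inj_on f (verts H)"
    using H.arc_total hom T.arc_irrefl by (metis inj_onI)
  interpret TW: tournament "T \<restriction> W"
    using sub unfolding W_def by (rule T.tournament_induce_subgraph)
  have iff: "f x \<rightarrow>\<^bsub>T \<restriction> W\<^esub> f y \<longleftrightarrow> x \<rightarrow>\<^bsub>H\<^esub> y" if "x \<in> verts H" "y \<in> verts H" for x y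
    using that hom H.arc_total T.arc_asym T.arc_irrefl
    unfolding arcs_ends_induce_subgraph W_def by (metis imageI)
  \<comment> \<open>An isomorphism must also map the arcs, which are abstract objects. Without
    parallel arcs \<open>arc_to_ends\<close> is injective, so \<open>k e\<close> is the unique arc
    of \<open>T \<restriction> W\<close> joining the images of the ends of \<open>e\<close>.\<close>
  define k where "k e = the_inv_into (arcs (T \<restriction> W)) (arc_to_ends (T \<restriction> W)) (f (tail H e), f (head H e))" for e
  have k: "k e \<in> arcs (T \<restriction> W)" "arc_to_ends (T \<restriction> W) (k e) = (f (tail H e), f (head H e))"
    if "e \<in> arcs H" for e
  proof -
    have "f (tail H e) \<rightarrow>\<^bsub>T \<restriction> W\<^esub> f (head H e)"
      using that by (subst iff) (auto simp: arcs_ends_conv)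
    then have im: "(f (tail H e), f (head H e)) \<in> arc_to_ends (T \<restriction> W) ` arcs (T \<restriction> W)"
      by (simp only: arcs_ends_def)
    show "k e \<in> arcs (T \<restriction> W)" unfolding k_def
      by (rule the_inv_into_into[OF TW.inj_on_arc_to_ends im subset_refl])
    show "arc_to_ends (T \<restriction> W) (k e) = (f (tail H e), f (head H e))" unfolding k_def
      by (rule f_the_inv_into_f[OF TW.inj_on_arc_to_ends im])
  qed
  have inj_k: "inj_on k (arcs H)"
  proof (rule inj_onI)
    fix d e assume "d \<in> arcs H" "e \<in> arcs H" "k d = k e"
    then have "f (tail H d) = f (tail H e)" "f (head H d) = f (head H e)"
      using k(2) by (metis Pair_inject)+
    then have "arc_to_ends H d = arc_to_ends H e"
      using inj \<open>d \<in> arcs H\<close> \<open>e \<in> arcs H\<close> by (auto simp: arc_to_ends_def dest: inj_onD)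
    then show "d = e" using \<open>d \<in> arcs H\<close> \<open>e \<in> arcs H\<close> by (simp add: H.no_multi_arcs)
  qed
  have onto: "k ` arcs H = arcs (T \<restriction> W)"
  proof
    show "k ` arcs H \<subseteq> arcs (T \<restriction> W)" using k(1) by blast
    show "arcs (T \<restriction> W) \<subseteq> k ` arcs H"
    proof
      fix e assume e: "e \<in> arcs (T \<restriction> W)"
      then obtain x y where xy: "x \<in> verts H" "y \<in> verts H" "arc_to_ends (T \<restriction> W) e = (f x, f y)"
        by (auto simp: W_def arc_to_ends_def)
      have "f x \<rightarrow>\<^bsub>T \<restriction> W\<^esub> f y" using e xy(3) unfolding arcs_ends_def by (metis imageI)
      then have "x \<rightarrow>\<^bsub>H\<^esub> y" using iff xy by simp
      then obtain d where d: "d \<in> arcs H" "tail H d = x" "head H d = y"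
        by (auto simp: arcs_ends_conv)
      then have "k d = e" using k[OF d(1)] e xy(3) TW.no_multi_arcs by metis
      then show "e \<in> k ` arcs H" using d(1) by blast
    qed
  qed
  \<comment> \<open>Taking head and tail from \<open>T\<close> makes \<open>app_iso h H\<close>
    equal to \<open>T \<restriction> W\<close> as a record, not merely on its arcs.\<close>
  define h where "h = \<lparr>iso_verts = f, iso_arcs = k, iso_head = head T, iso_tail = tail T\<rparr>"
  have "H.digraph_isomorphism h"
    using inj inj_k k(2) unfolding H.digraph_isomorphism_def h_def
    by (auto simp: arc_to_ends_def H.wf_digraph)
  moreover have "T \<restriction> W = app_iso h H"
    using onto by (intro pre_digraph.equality) (auto simp: h_def W_def)
  ultimately have "digraph_iso (T \<restriction> W) H"
    using digraph_iso_swap[OF H.wf_digraph] unfolding digraph_iso_def by blast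
  moreover have "card W = card (verts H)" unfolding W_def by (rule card_image[OF inj])
  ultimately show ?thesis using sub unfolding has_copy_def W_def by blast
qed

lemma has_copy_induce_subgraph:
  assumes "tournament T" "tournament H" "W \<subseteq> verts T" "has_copy (T \<restriction> W) H"
  shows "has_copy T H"
proof -
  interpret T: tournament T by fact
  obtain f where f: "f ` verts H \<subseteq> verts (T \<restriction> W)"
    "\<And>x y. x \<rightarrow>\<^bsub>H\<^esub> y \<Longrightarrow> f x \<rightarrow>\<^bsub>T \<restriction> W\<^esub> f y"
    using has_copyE[OF T.tournament_induce_subgraph[OF assms(3)] assms(4)] by metis
  show ?thesis
  proof (rule has_copyI[OF assms(1,2)])
    show "f ` verts H \<subseteq> verts T" using f(1) assms(3) by auto
    show "f x \<rightarrow>\<^bsub>T\<^esub> f y" if "x \<rightarrow>\<^bsub>H\<^esub> y" for x y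
      using f(2)[OF that] by (simp add: arcs_ends_induce_subgraph)
  qed
qed

subsection \<open>Decomposable tournaments have no forbidden copies\<close>

text \<open>One level of the decomposition. In a tournament the parts are automatically disjoint,
  since a common vertex of two parts would carry a loop. A part may be empty.\<close>

definition C3_split :: "('a, 'b) pre_digraph \<Rightarrow> 'a set \<Rightarrow> 'a set \<Rightarrow> 'a set \<Rightarrow> bool" where
  "C3_split T A B C \<longleftrightarrow> A \<subset> verts T \<and> B \<subset> verts T \<and> C \<subset> verts T \<and> A \<union> B \<union> C = verts T \<and>
    A \<times> B \<subseteq> arcs_ends T \<and> B \<times> C \<subseteq> arcs_ends T \<and> C \<times> A \<subseteq> arcs_ends T"

text \<open>Pulling the partition of \<open>T\<close> back along an embedding of \<open>H\<close>
  would split \<open>H\<close>. The pulled-back parts are proper because, by induction, no part of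
  \<open>T\<close> contains a whole copy of \<open>H\<close>.\<close>

lemma C3_decomposable_imp_no_copy:
  assumes "C3_decomposable T" and H: "tournament H" "card (verts H) \<ge> 2"
    and unsplit: "\<And>A B C. \<not> C3_split H A B C"
  shows "\<not> has_copy T H"
  using assms(1)
proof induction
  case (small T)
  interpret T: tournament T by fact
  show ?case
  proof
    assume "has_copy T H"
    then obtain f where "inj_on f (verts H)" "f ` verts H \<subseteq> verts T"
      using has_copyE[OF small(1)] by metis
    then have "card (verts H) \<le> card (verts T)" by (metis T.finite_verts card_inj_on_le)
    then show False using small(2) H(2) by linarith
  qed
next
  case (decompose T A B C)
  interpret T: tournament T by fact
  interpret H: tournament H by fact
  show ?case
  proof
    assume "has_copy T H"
    then obtain f where f: "f ` verts H \<subseteq> verts T" "\<And>x y. x \<rightarrow>\<^bsub>H\<^esub> y \<Longrightarrow> f x \<rightarrow>\<^bsub>T\<^esub> f y"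
      using has_copyE[OF decompose(1)] by metis
    have not_inside: "\<not> f ` verts H \<subseteq> W" if W: "W \<subset> verts T" "\<not> has_copy (T \<restriction> W) H" for W
    proof
      assume "f ` verts H \<subseteq> W"
      then have "has_copy (T \<restriction> W) H"
        using f(2) H(1) H.adj_in_verts W(1)
        by (intro has_copyI[of _ _ f] T.tournament_induce_subgraph)
          (auto simp: arcs_ends_induce_subgraph)
      then show False using W(2) by simp
    qed
    define P where "P X = {x \<in> verts H. f x \<in> X}" for X
    have proper: "P W \<subset> verts H" if "W \<subset> verts T" "\<not> has_copy (T \<restriction> W) H" for W
      using not_inside[OF that] by (auto simp: P_def)
    \<comment> \<open>The arc between the images forces distinct preimages, and an arc of
      \<open>H\<close> in the opposite direction would be mapped against it.\<close>
    have arcs: "P X \<times> P Y \<subseteq> arcs_ends H" if XY: "X \<times> Y \<subseteq> arcs_ends T" for X Y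
    proof clarify
      fix x y assume "x \<in> P X" "y \<in> P Y"
      then have "x \<in> verts H" "y \<in> verts H" "f x \<rightarrow>\<^bsub>T\<^esub> f y" using XY by (auto simp: P_def)
      then show "x \<rightarrow>\<^bsub>H\<^esub> y"
        by (metis H.arc_total T.arc_asym T.arc_irrefl f(2))
    qed
    have "P A \<union> P B \<union> P C = verts H" using f(1) decompose.hyps by (auto simp: P_def)
    then have "C3_split H (P A) (P B) (P C)"
      unfolding C3_split_def using decompose.hyps decompose.IH by (simp add: proper arcs)
    then show False using unsplit by blast
  qed
qed

section \<open>The forbidden tournaments cannot be split\<close>

lemma T5_8_simps:
  "verts T5_8 = {1, 2, 3, 4, 5}"
  "arcs_ends T5_8 = {(1,2), (1,3), (1,4), (2,3), (2,4), (2,5), (3,4), (4,5), (5,1), (5,3)}"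
  by (simp_all add: T5_8_def)

lemma T5_10_simps:
  "verts T5_10 = {1, 2, 3, 4, 5}"
  "arcs_ends T5_10 = {(1,2), (1,4), (2,3), (2,4), (3,1), (3,4), (3,5), (4,5), (5,1), (5,2)}"
  by (simp_all add: T5_10_def)

lemma T5_12_simps:
  "verts T5_12 = {0, 1, 2, 3, 4}"
  "arcs_ends T5_12 = {(0,2), (1,3), (2,4), (3,0), (4,1), (0,1), (1,2), (2,3), (3,4), (4,0)}"
proof -
  have V: "{0..<5} = {0, 1, 2, 3, 4::nat}" by auto
  then show "verts T5_12 = {0, 1, 2, 3, 4}" by (simp add: T5_12_def)
  have *: "{(i, (i + k) mod 5) | i. i < (5::nat)} = (\<lambda>i. (i, (i + k) mod 5)) ` {0, 1, 2, 3, 4}" for k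
    unfolding V[symmetric] by auto
  show "arcs_ends T5_12 = {(0,2), (1,3), (2,4), (3,0), (4,1), (0,1), (1,2), (2,3), (3,4), (4,0)}"
    unfolding T5_12_def with_proj_simps pair_pre_digraph.select_convs * by (simp add: numeral_2_eq_2)
qed

text \<open>Rotating the three parts puts the chosen vertex \<open>a\<close> into the first one. The
  remaining conditions are quantified over vertices and arcs only, so for an explicit tournament
  they unfold to a finite propositional problem: no arc may run backwards between parts.\<close>

lemma not_C3_splitI:
  assumes "tournament T" "a \<in> verts T"
    and contra: "\<And>A B C. \<lbrakk>a \<in> A; \<exists>x\<in>verts T. x \<notin> A; \<forall>x\<in>verts T. x \<in> A \<or> x \<in> B \<or> x \<in> C;
      \<forall>x\<in>verts T. \<not> (x \<in> A \<and> x \<in> B) \<and> \<not> (x \<in> B \<and> x \<in> C) \<and> \<not> (x \<in> C \<and> x \<in> A);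
      \<forall>(x, y)\<in>arcs_ends T. \<not> (y \<in> A \<and> x \<in> B) \<and> \<not> (y \<in> B \<and> x \<in> C) \<and> \<not> (y \<in> C \<and> x \<in> A)\<rbrakk>
      \<Longrightarrow> False"
  shows "\<not> C3_split T A B C"
proof
  interpret tournament T by fact
  assume split: "C3_split T A B C"
  then have rot: "C3_split T B C A" "C3_split T C A B" by (auto simp: C3_split_def)
  have False if "C3_split T A B C" "a \<in> A" for A B C
  proof (rule contra)
    show "\<exists>x\<in>verts T. x \<notin> A" "\<forall>x\<in>verts T. x \<in> A \<or> x \<in> B \<or> x \<in> C"
      using that(1) by (auto simp: C3_split_def)
    have arcs: "x \<rightarrow>\<^bsub>T\<^esub> y" if "x \<in> A \<and> y \<in> B \<or> x \<in> B \<and> y \<in> C \<or> x \<in> C \<and> y \<in> A" for x y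
      using that \<open>C3_split T A B C\<close> unfolding C3_split_def by blast
    show "\<forall>x\<in>verts T. \<not> (x \<in> A \<and> x \<in> B) \<and> \<not> (x \<in> B \<and> x \<in> C) \<and> \<not> (x \<in> C \<and> x \<in> A)"
      using arcs arc_irrefl by blast
    show "\<forall>(x, y)\<in>arcs_ends T. \<not> (y \<in> A \<and> x \<in> B) \<and> \<not> (y \<in> B \<and> x \<in> C) \<and> \<not> (y \<in> C \<and> x \<in> A)"
      using arcs arc_asym by blast
  qed (fact that(2))
  moreover have "a \<in> A \<union> B \<union> C" using split assms(2) by (simp add: C3_split_def)
  ultimately show False using split rot by blast
qed

lemma not_C3_split_T5_8: "\<not> C3_split T5_8 A B C"
proof (rule not_C3_splitI[OF tournament_T5_8, of 1], goal_cases)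
  case (2 A B C)
  then show False unfolding T5_8_simps by auto
qed (simp add: T5_8_simps)

lemma not_C3_split_T5_10: "\<not> C3_split T5_10 A B C"
proof (rule not_C3_splitI[OF tournament_T5_10, of 1], goal_cases)
  case (2 A B C)
  then show False unfolding T5_10_simps
    by (cases "2 \<in> A"; cases "3 \<in> A"; cases "4 \<in> A"; simp)
qed (simp add: T5_10_simps)

lemma not_C3_split_T5_12: "\<not> C3_split T5_12 A B C"
proof (rule not_C3_splitI[OF tournament_T5_12, of 0], goal_cases)
  case (2 A B C)
  then show False unfolding T5_12_simps
    by (cases "2 \<in> A"; cases "3 \<in> A"; cases "4 \<in> A"; simp)
qed (simp add: T5_12_simps)

subsection \<open>Tournaments without forbidden copies\<close>

abbreviation has_forbidden_copy :: "('a, 'b) pre_digraph \<Rightarrow> bool" where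
  "has_forbidden_copy T \<equiv> has_copy T T5_8 \<or> has_copy T T5_10 \<or> has_copy T T5_12"

context tournament
begin

lemma has_copy_T5_8I:
  assumes "a \<rightarrow> b" "a \<rightarrow> c" "a \<rightarrow> d" "b \<rightarrow> c" "b \<rightarrow> d" "b \<rightarrow> e" "c \<rightarrow> d" "d \<rightarrow> e" "e \<rightarrow> a" "e \<rightarrow> c"
  shows "has_copy G T5_8"
proof (rule has_copyI[OF tournament_axioms tournament_T5_8])
  \<comment> \<open>The shift by one reflects that the vertices are numbered from 1.\<close>
  let ?f = "\<lambda>i. [a, b, c, d, e] ! (i - 1)"
  have "{a, b, c, d, e} \<subseteq> verts G" using assms adj_in_verts by blast
  then show "?f ` verts T5_8 \<subseteq> verts G" by (simp add: T5_8_simps)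
  show "?f x \<rightarrow> ?f y" if "x \<rightarrow>\<^bsub>T5_8\<^esub> y" for x y
    using that assms by (auto simp: T5_8_simps)
qed

lemma has_copy_T5_10I:
  assumes "a \<rightarrow> b" "b \<rightarrow> c" "a \<rightarrow> d" "b \<rightarrow> d" "c \<rightarrow> a" "c \<rightarrow> d" "c \<rightarrow> e" "d \<rightarrow> e" "e \<rightarrow> a" "e \<rightarrow> b"
  shows "has_copy G T5_10"
proof (rule has_copyI[OF tournament_axioms tournament_T5_10])
  let ?f = "\<lambda>i. [a, b, c, d, e] ! (i - 1)"
  have "{a, b, c, d, e} \<subseteq> verts G" using assms adj_in_verts by blast
  then show "?f ` verts T5_10 \<subseteq> verts G" by (simp add: T5_10_simps)
  show "?f x \<rightarrow> ?f y" if "x \<rightarrow>\<^bsub>T5_10\<^esub> y" for x y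
    using that assms by (auto simp: T5_10_simps)
qed

lemma has_copy_T5_12I:
  assumes "a \<rightarrow> b" "a \<rightarrow> c" "b \<rightarrow> c" "b \<rightarrow> d" "c \<rightarrow> d" "c \<rightarrow> e" "d \<rightarrow> e" "d \<rightarrow> a" "e \<rightarrow> a" "e \<rightarrow> b"
  shows "has_copy G T5_12"
proof (rule has_copyI[OF tournament_axioms tournament_T5_12])
  \<comment> \<open>No shift here: the residues start at 0.\<close>
  let ?f = "\<lambda>i. [a, b, c, d, e] ! i"
  have "{a, b, c, d, e} \<subseteq> verts G" using assms adj_in_verts by blast
  then show "?f ` verts T5_12 \<subseteq> verts G" by (simp add: T5_12_simps)
  show "?f x \<rightarrow> ?f y" if "x \<rightarrow>\<^bsub>T5_12\<^esub> y" for x y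
    using that assms by (auto simp: T5_12_simps)
qed

section \<open>Cyclic triples and their enlargement\<close>

text \<open>A partial split: the parts must be nonempty but need not cover all vertices, so that it
  can be enlarged step by step.\<close>

definition cyclic_triple :: "'a set \<Rightarrow> 'a set \<Rightarrow> 'a set \<Rightarrow> bool" where
  "cyclic_triple A B C \<longleftrightarrow> A \<noteq> {} \<and> B \<noteq> {} \<and> C \<noteq> {} \<and>
    A \<times> B \<subseteq> arcs_ends G \<and> B \<times> C \<subseteq> arcs_ends G \<and> C \<times> A \<subseteq> arcs_ends G"

lemma cyclic_triple_rotate: "cyclic_triple A B C \<Longrightarrow> cyclic_triple B C A"
  by (simp add: cyclic_triple_def)

text \<open>As no part is empty, every vertex of the triple is an end of some arc.\<close>

lemma cyclic_triple_subset_verts: "cyclic_triple A B C \<Longrightarrow> A \<union> B \<union> C \<subseteq> verts G"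
  unfolding cyclic_triple_def using adj_in_verts by blast

lemma cyclic_triple_insert:
  assumes "cyclic_triple A B C" "\<forall>b\<in>B. v \<rightarrow> b" "\<forall>c\<in>C. c \<rightarrow> v"
  shows "cyclic_triple (insert v A) B C"
  using assms by (auto simp: cyclic_triple_def)

text \<open>A vertex \<open>v\<close> that is mixed on \<open>A\<close> must behave towards
  \<open>B\<close> and \<open>C\<close> like a vertex of \<open>A\<close>: if some \<open>b\<close>
  and \<open>c\<close> violate this, the five vertices \<open>a1\<close>, \<open>a2\<close>,
  \<open>v\<close>, \<open>b\<close>, \<open>c\<close> span a forbidden tournament.\<close>

lemma cyclic_triple_mixed:
  assumes free: "\<not> has_forbidden_copy G" and abc: "cyclic_triple A B C"
    and v: "v \<in> verts G" "v \<notin> A \<union> B \<union> C"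
    and a: "a1 \<in> A" "a2 \<in> A" "a1 \<rightarrow> v" "v \<rightarrow> a2"
  shows "cyclic_triple (insert v A) B C"
proof -
  have "v \<rightarrow> b \<and> c \<rightarrow> v" if bc: "b \<in> B" "c \<in> C" for b c
  proof (rule ccontr)
    assume "\<not> (v \<rightarrow> b \<and> c \<rightarrow> v)"
    moreover have "b \<in> verts G" "c \<in> verts G" "a1 \<in> verts G" "a2 \<in> verts G"
      using cyclic_triple_subset_verts[OF abc] bc a by auto
    ultimately have "v \<rightarrow> b \<and> v \<rightarrow> c \<or> b \<rightarrow> v \<and> v \<rightarrow> c \<or> b \<rightarrow> v \<and> c \<rightarrow> v"
      using v bc arc_total by blast
    moreover have "a1 \<rightarrow> a2 \<or> a2 \<rightarrow> a1"
      using arc_total \<open>a1 \<in> verts G\<close> \<open>a2 \<in> verts G\<close> a(3,4) arc_asym by metis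
    moreover have "a1 \<rightarrow> b" "a2 \<rightarrow> b" "b \<rightarrow> c" "c \<rightarrow> a1" "c \<rightarrow> a2"
      using abc a(1,2) bc by (auto simp: cyclic_triple_def)
    \<comment> \<open>Three bad patterns of \<open>v\<close> towards \<open>b\<close> and
      \<open>c\<close>, times two directions between \<open>a1\<close> and \<open>a2\<close>, give
      six tournaments: \<open>T5_8\<close> twice, \<open>T5_10\<close> three times,
      \<open>T5_12\<close> once. Each listed instance settles exactly one of them.\<close>
    ultimately have "has_forbidden_copy G"
      using a(3,4) has_copy_T5_8I[of a1 v a2 b c] has_copy_T5_8I[of c a1 v a2 b]
        has_copy_T5_10I[of a2 a1 v b c] has_copy_T5_10I[of a1 b c v a2]
        has_copy_T5_10I[of v c a1 a2 b] has_copy_T5_12I[of a1 b v c a2]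
      by argo
    then show False using free by simp
  qed
  then show ?thesis
    using abc by (intro cyclic_triple_insert) (auto simp: cyclic_triple_def)
qed

text \<open>If \<open>v\<close> is mixed on some part, it joins that part. Otherwise its direction
  is constant on each part but not the same for all three, so going around the cycle a part below
  \<open>v\<close> is followed at some point by a part above \<open>v\<close>; then \<open>v\<close>
  joins the third part.\<close>

lemma cyclic_triple_extend:
  assumes free: "\<not> has_forbidden_copy G" and abc: "cyclic_triple A B C"
    and v: "v \<in> verts G" "v \<notin> A \<union> B \<union> C"
    and not_uniform: "\<exists>s\<in>A \<union> B \<union> C. \<not> v \<rightarrow> s" "\<exists>s\<in>A \<union> B \<union> C. \<not> s \<rightarrow> v"
  shows "\<exists>A' B' C'. cyclic_triple A' B' C' \<and> A' \<union> B' \<union> C' = insert v (A \<union> B \<union> C)"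
proof -
  note bca = cyclic_triple_rotate[OF abc]
  note cab = cyclic_triple_rotate[OF bca]
  have tot: "s \<rightarrow> v \<or> v \<rightarrow> s" if "s \<in> A \<union> B \<union> C" for s
    using that v cyclic_triple_subset_verts[OF abc] arc_total by blast
  have "cyclic_triple (insert v A) B C \<or> cyclic_triple (insert v B) C A \<or> cyclic_triple (insert v C) A B"
  proof (cases "\<exists>X\<in>{A, B, C}. \<exists>x\<in>X. \<exists>y\<in>X. x \<rightarrow> v \<and> v \<rightarrow> y")
    case True
    then show ?thesis
      using cyclic_triple_mixed[OF free abc] cyclic_triple_mixed[OF free bca]
        cyclic_triple_mixed[OF free cab] v by blast
  next
    case False
    have hom: "(\<forall>x\<in>X. v \<rightarrow> x) \<or> (\<forall>x\<in>X. x \<rightarrow> v)" if "X \<in> {A, B, C}" for X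
      using False that tot by blast
    have "(\<forall>x\<in>A. v \<rightarrow> x) \<or> (\<forall>x\<in>A. x \<rightarrow> v)" "(\<forall>x\<in>B. v \<rightarrow> x) \<or> (\<forall>x\<in>B. x \<rightarrow> v)"
      "(\<forall>x\<in>C. v \<rightarrow> x) \<or> (\<forall>x\<in>C. x \<rightarrow> v)"
      by (simp_all add: hom)
    then show ?thesis
      using not_uniform cyclic_triple_insert[OF abc] cyclic_triple_insert[OF bca]
        cyclic_triple_insert[OF cab] by blast
  qed
  then show ?thesis by blast
qed

text \<open>The outside vertices form a set \<open>U\<close> below \<open>S\<close> and a set
  \<open>W\<close> above \<open>S\<close>. An arc from \<open>U\<close> to \<open>W\<close> closes a
  cycle through \<open>S\<close>; if there is none, \<open>W\<close>, \<open>S\<close>,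
  \<open>U\<close> are layers with all arcs pointing down, and cutting between two layers gives a
  split with empty third part.\<close>

lemma split_or_cyclic_triple_superset:
  assumes S: "S \<subseteq> verts G" "S \<noteq> {}" "S \<noteq> verts G"
    and uniform: "\<And>v. v \<in> verts G - S \<Longrightarrow> (\<forall>s\<in>S. v \<rightarrow> s) \<or> (\<forall>s\<in>S. s \<rightarrow> v)"
  shows "(\<exists>A B. C3_split G A B {}) \<or> (\<exists>A B C. cyclic_triple A B C \<and> S \<subset> A \<union> B \<union> C)"
proof -
  define U where "U = {u \<in> verts G - S. \<forall>s\<in>S. s \<rightarrow> u}"
  define W where "W = {w \<in> verts G - S. \<forall>s\<in>S. w \<rightarrow> s}"
  have UW: "U \<union> W = verts G - S" using uniform by (auto simp: U_def W_def)
  have "U \<inter> W = {}" using S(2) arc_asym by (fastforce simp: U_def W_def)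
  have tot: "u \<rightarrow> w \<or> w \<rightarrow> u" if "u \<in> U" "w \<in> W" for u w
    using that \<open>U \<inter> W = {}\<close> arc_total[of u w] by (auto simp: U_def W_def)
  consider (backward) u w where "u \<in> U" "w \<in> W" "u \<rightarrow> w"
    | (forward) "\<forall>u\<in>U. \<forall>w\<in>W. w \<rightarrow> u"
    using tot by blast
  then show ?thesis
  proof cases
    case backward
    then have "cyclic_triple S {u} {w}" using S(2) by (auto simp: cyclic_triple_def U_def W_def)
    moreover have "S \<subset> S \<union> {u} \<union> {w}" using backward by (auto simp: U_def)
    ultimately show ?thesis by blast
  next
    case forward
    show ?thesis
    \<comment> \<open>The cut is made just above \<open>U\<close>; if \<open>U\<close> is empty it
      is made between \<open>W\<close> and \<open>S\<close>, where \<open>W\<close> is nonempty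
      because \<open>S\<close> is not everything.\<close>
    proof (cases "U = {}")
      case True
      then have "C3_split G W S {}" using S UW by (auto simp: C3_split_def W_def)
      then show ?thesis by blast
    next
      case False
      have "U \<inter> S = {}" by (auto simp: U_def)
      then have "W \<union> S \<subset> verts G" "U \<subset> verts G" "{} \<subset> verts G" "W \<union> S \<union> U \<union> {} = verts G"
        using S(1,2) UW \<open>U \<inter> W = {}\<close> False by blast+
      moreover have "(W \<union> S) \<times> U \<subseteq> arcs_ends G" using forward by (auto simp: U_def)
      ultimately have "C3_split G (W \<union> S) U {}" by (simp add: C3_split_def)
      then show ?thesis by blast
    qed
  qed
qed

lemma forbidden_free_imp_C3_split:
  assumes free: "\<not> has_forbidden_copy G" and card: "card (verts G) \<ge> 2"
  shows "\<exists>A B C. C3_split G A B C"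
proof (rule ccontr)
  assume no_split: "\<nexists>A B C. C3_split G A B C"
  define F where "F = {A \<union> B \<union> C | A B C. cyclic_triple A B C}"
  have "F \<subseteq> Pow (verts G)" unfolding F_def by (blast dest!: cyclic_triple_subset_verts)
  then have "finite F" by (rule finite_subset) simp
  obtain x where x: "x \<in> verts G" using card by fastforce
  have "verts G \<noteq> {x}" using card by auto
  \<comment> \<open>Every other vertex is trivially above or below all of a singleton. This supplies
    a first cyclic triple, so that a maximal one exists.\<close>
  then have "(\<exists>A B. C3_split G A B {}) \<or> (\<exists>A B C. cyclic_triple A B C \<and> {x} \<subset> A \<union> B \<union> C)"
    using x arc_total[of _ x] by (intro split_or_cyclic_triple_superset) auto
  then have "\<exists>A B C. cyclic_triple A B C" using no_split by blast
  then have "F \<noteq> {}" by (auto simp: F_def)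
  then obtain S where S: "S \<in> F" and max: "\<forall>S'\<in>F. S \<subseteq> S' \<longrightarrow> S = S'"
    using finite_has_maximal[OF \<open>finite F\<close>] by metis
  then obtain A B C where abc: "cyclic_triple A B C" "S = A \<union> B \<union> C" by (auto simp: F_def)
  show False
  proof (cases "S = verts G")
    case True
    \<comment> \<open>Disjointness together with nonemptiness makes each part a proper subset of the
      vertices.\<close>
    moreover have "A \<inter> B = {}" "B \<inter> C = {}" "C \<inter> A = {}"
      using abc(1) arc_irrefl by (auto simp: cyclic_triple_def)
    ultimately have "C3_split G A B C" using abc by (auto simp: C3_split_def cyclic_triple_def)
    then show False using no_split by blast
  next
    case False
    have "(\<forall>s\<in>S. v \<rightarrow> s) \<or> (\<forall>s\<in>S. s \<rightarrow> v)" if v: "v \<in> verts G - S" for v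
    proof (rule ccontr)
      assume "\<not> ?thesis"
      then have "\<exists>A' B' C'. cyclic_triple A' B' C' \<and> A' \<union> B' \<union> C' = insert v (A \<union> B \<union> C)"
        using v unfolding abc(2) by (intro cyclic_triple_extend[OF free abc(1)]) blast+
      then have "insert v S \<in> F" unfolding F_def abc(2) mem_Collect_eq by metis
      then have "S = insert v S" using max subset_insertI by metis
      then show False using v by auto
    qed
    moreover have "S \<subseteq> verts G" "S \<noteq> {}"
      using abc(2) cyclic_triple_subset_verts[OF abc(1)] abc(1) by (auto simp: cyclic_triple_def)
    ultimately have "(\<exists>A B. C3_split G A B {}) \<or> (\<exists>A B C. cyclic_triple A B C \<and> S \<subset> A \<union> B \<union> C)"
      using False by (intro split_or_cyclic_triple_superset)
    then obtain A' B' C' where "cyclic_triple A' B' C'" and larger: "S \<subset> A' \<union> B' \<union> C'"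
      using no_split by blast
    then have "A' \<union> B' \<union> C' \<in> F" unfolding F_def mem_Collect_eq by metis
    then show False using max larger by (metis psubset_eq)
  qed
qed

end

section \<open>Recursion and the characterization\<close>

text \<open>Strong induction on the number of vertices: the parts of a split are smaller, and a copy
  inside a part would be a copy in \<open>T\<close>.\<close>

lemma forbidden_free_imp_C3_decomposable:
  assumes "tournament T" "\<not> has_forbidden_copy T"
  shows "C3_decomposable T"
  using assms
proof (induction "card (verts T)" arbitrary: T rule: less_induct)
  case less
  interpret tournament T by fact
  show ?case
  proof (cases "card (verts T) \<le> 1")
    case True
    with less.prems(1) show ?thesis by (rule C3_decomposable.small)
  next
    case False
    then have card: "card (verts T) \<ge> 2" by simp
    then obtain A B C where split: "C3_split T A B C"
      using forbidden_free_imp_C3_split less.prems(2) by blast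
    have sub: "C3_decomposable (T \<restriction> W)" if W: "W \<subset> verts T" for W
    proof (rule less.hyps)
      show "card (verts (T \<restriction> W)) < card (verts T)" using W by (simp add: psubset_card_mono)
      show "tournament (T \<restriction> W)" using W by (intro tournament_induce_subgraph) auto
      show "\<not> has_forbidden_copy (T \<restriction> W)"
        using less.prems(2) W has_copy_induce_subgraph[OF less.prems(1) tournament_T5_8]
          has_copy_induce_subgraph[OF less.prems(1) tournament_T5_10]
          has_copy_induce_subgraph[OF less.prems(1) tournament_T5_12]
        by (metis psubset_imp_subset)
    qed
    have disj: "A \<inter> B = {}" "B \<inter> C = {}" "C \<inter> A = {}"
      using split arc_irrefl by (auto simp: C3_split_def)
    have parts: "A \<subset> verts T" "B \<subset> verts T" "C \<subset> verts T" "A \<union> B \<union> C = verts T"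
      "A \<times> B \<subseteq> arcs_ends T" "B \<times> C \<subseteq> arcs_ends T" "C \<times> A \<subseteq> arcs_ends T"
      using split by (simp_all add: C3_split_def)
    show ?thesis
      by (rule C3_decomposable.decompose[OF less.prems(1) card parts(1-3) disj parts(4)
            sub[OF parts(1)] sub[OF parts(2)] sub[OF parts(3)] parts(5-7)])
  qed
qed

theorem theorem6p10:
  fixes T :: "('a, 'b) pre_digraph"
  assumes "tournament T"
  shows "C3_decomposable T \<longleftrightarrow>
    \<not> has_copy T T5_8 \<and> \<not> has_copy T T5_10 \<and> \<not> has_copy T T5_12"
proof
  assume dec: "C3_decomposable T"
  show "\<not> has_copy T T5_8 \<and> \<not> has_copy T T5_10 \<and> \<not> has_copy T T5_12"
    by (intro conjI C3_decomposable_imp_no_copy[OF dec] tournament_T5_8 tournament_T5_10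
        tournament_T5_12 not_C3_split_T5_8 not_C3_split_T5_10 not_C3_split_T5_12)
      (simp_all add: T5_8_simps T5_10_simps T5_12_simps)
next
  assume "\<not> has_copy T T5_8 \<and> \<not> has_copy T T5_10 \<and> \<not> has_copy T T5_12"
  then show "C3_decomposable T" using forbidden_free_imp_C3_decomposable[OF assms] by blast
qed

end
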